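(* Let $G$ be a finite abelian group with subgroup $H$. Then: (i) For every $f\in\ell(H)$, $$\widehat{\mathcal{S}^{*}_{H}f}(\chi)=\hat f(\chi|_H),\qquad \chi\in\widehat G .$$ (ii) For every $f\in\ell(G)$, $$\widehat{\mathcal{S}_{H}f}(\chi)=\frac{1}{[G:H]}\sum_{\psi\in\widehat G_\chi}\hat f(\psi),\qquad \chi\in\widehat H .$$
   Context: For a finite abelian group $K$ (written multiplicatively), $\ell(K)$ is the space of complex-valued functions on $K$. A character of $K$ is a group homomorphism from $K$ to the multiplicative group $\mathbb{T}$ of unimodular complex numbers, and $\widehat K$ is the group of all characters of $K$ under pointwise multiplication. The discrete Fourier transform of $f\in\ell(K)$ is $\hat f(\chi)=\sum_{x\in K}f(x)\overline{\chi(x)}$ for $\chi\in\widehat K$. This applies to both $K=G$ and $K=H$. For a subgroup $H\le G$, the sampling operator $\mathcal{S}_H:\ell(G)\to\ell(H)$ is $(\mathcal{S}_Hf)(h)=f(h)$ for $h\in H$. The upsampling operator $\mathcal{S}^{*}_H:\ell(H)\to\ell(G)$ is $(\mathcal{S}^{*}_Hf)(g)=f(g)$ if $g\in H$ and $(\mathcal{S}^{*}_Hf)(g)=0$ if $g\in G\setminus H$. For $\chi\in\widehat H$, $\widehat G_\chi=\{\psi\in\widehat G:\psi|_H=\chi\}$. *)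

theory Defs
  imports Complex_Main "HOL-Algebra.Algebra"
begin

text \<open>
  A function on (the carrier of) a group is represented by its extensional representative, i.e. it
  takes the value \<open>undefined\<close> outside of the carrier. Thus two such functions are equal in HOL iff
  they agree on the carrier; in particular each character is counted once in a sum over characters.
  A subgroup \<open>H\<close> of \<open>G\<close> is regarded as a group in its own right as \<open>G\<lparr>carrier := H\<rparr>\<close>.
\<close>

definition ell :: "('a, 'm) monoid_scheme \<Rightarrow> ('a \<Rightarrow> complex) set" where
  "ell K = carrier K \<rightarrow>\<^sub>E UNIV"

definition circle_group :: "complex monoid" where
  "circle_group = \<lparr>carrier = {z. cmod z = 1}, monoid.mult = (*), one = 1\<rparr>"

definition dual_group :: "('a, 'm) monoid_scheme \<Rightarrow> ('a \<Rightarrow> complex) monoid" where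
  "dual_group K =
     \<lparr>carrier = hom K circle_group \<inter> extensional (carrier K),
      monoid.mult = (\<lambda>\<chi> \<psi>. \<lambda>x\<in>carrier K. \<chi> x * \<psi> x),
      one = (\<lambda>x\<in>carrier K. 1)\<rparr>"

definition dft :: "('a, 'm) monoid_scheme \<Rightarrow> ('a \<Rightarrow> complex) \<Rightarrow> ('a \<Rightarrow> complex) \<Rightarrow> complex" where
  "dft K f = (\<lambda>\<chi>\<in>carrier (dual_group K). \<Sum>x\<in>carrier K. f x * cnj (\<chi> x))"

definition sampling :: "'a set \<Rightarrow> ('a \<Rightarrow> complex) \<Rightarrow> 'a \<Rightarrow> complex" where
  "sampling H f = (\<lambda>h\<in>H. f h)"

definition upsampling ::
  "('a, 'm) monoid_scheme \<Rightarrow> 'a set \<Rightarrow> ('a \<Rightarrow> complex) \<Rightarrow> 'a \<Rightarrow> complex" where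
  "upsampling G H f = (\<lambda>g\<in>carrier G. if g \<in> H then f g else 0)"

definition characters_extending ::
  "('a, 'm) monoid_scheme \<Rightarrow> 'a set \<Rightarrow> ('a \<Rightarrow> complex) \<Rightarrow> ('a \<Rightarrow> complex) set" where
  "characters_extending G H \<chi> = {\<psi> \<in> carrier (dual_group G). restrict \<psi> H = \<chi>}"

definition subgroup_index :: "('a, 'm) monoid_scheme \<Rightarrow> 'a set \<Rightarrow> nat" where
  "subgroup_index G H = card (rcosets\<^bsub>G\<^esub> H)"

lemma comm_group_circle_group: "comm_group circle_group"
proof (rule comm_groupI)
  fix x assume x: "x \<in> carrier circle_group"
  then have "x \<noteq> 0"
    by (auto simp: circle_group_def)
  with x show "\<exists>y\<in>carrier circle_group. y \<otimes>\<^bsub>circle_group\<^esub> x = \<one>\<^bsub>circle_group\<^esub>"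
    by (intro bexI[of _ "inverse x"]) (auto simp: circle_group_def norm_inverse)
qed (auto simp: circle_group_def norm_mult)

lemma comm_group_dual_group:
  assumes "group K"
  shows "comm_group (dual_group K)"
proof -
  interpret group K by fact
  show ?thesis
  proof (rule comm_groupI)
    fix \<chi> assume \<chi>: "\<chi> \<in> carrier (dual_group K)"
    then have [simp]: "\<chi> x \<noteq> 0" if "x \<in> carrier K" for x
      using that by (force simp: dual_group_def circle_group_def hom_def)
    show "\<exists>\<psi>\<in>carrier (dual_group K). \<psi> \<otimes>\<^bsub>dual_group K\<^esub> \<chi> = \<one>\<^bsub>dual_group K\<^esub>"
      using \<chi>
      by (intro bexI[of _ "\<lambda>x\<in>carrier K. inverse (\<chi> x)"])
         (auto simp: dual_group_def circle_group_def hom_def norm_inverse fun_eq_iff Pi_iff)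
  qed (auto simp: dual_group_def circle_group_def hom_def norm_mult fun_eq_iff Pi_iff
        extensional_def)
qed

lemma restrict_in_dual_group:
  assumes "subgroup H G" "\<chi> \<in> carrier (dual_group G)"
  shows "restrict \<chi> H \<in> carrier (dual_group (G\<lparr>carrier := H\<rparr>))"
  using assms subgroup.subset[OF assms(1)] subgroup.m_closed[OF assms(1)]
  by (auto simp: dual_group_def hom_def Pi_iff subset_iff)

end

theory Submission
  imports Defs
begin

text \<open>
  Part (i) holds because upsampling pads by zero, so that the sum over \<open>G\<close> is a sum over \<open>H\<close>.

  For part (ii), exchange the two sums on the right-hand side. What has to be shown is that
  the sum of \<open>\<psi> x\<close> over all characters \<open>\<psi>\<close> of \<open>G\<close> extending \<open>\<chi>\<close> is \<open>[G:H] * \<chi> x\<close> for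
  \<open>x \<in> H\<close>, and zero for \<open>x \<notin> H\<close>.
  For \<open>x \<notin> H\<close> there is a character \<open>\<theta>\<close> of \<open>G\<close> that is trivial on \<open>H\<close> but not at \<open>x\<close>
  (\<open>separating_character\<close>); multiplication by \<open>\<theta>\<close> permutes the extensions of \<open>\<chi>\<close>, so the sum is
  multiplied by \<open>\<theta> x \<noteq> 1\<close> and left unchanged at the same time (\<open>sum_extensions_outside\<close>).
  For \<open>x \<in> H\<close> the claim is that there are exactly \<open>[G:H]\<close> extensions
  (\<open>card_characters_extending\<close>). Fix one of them, \<open>\<psi>\<^sub>0\<close>, and sum \<open>\<psi> x * cnj (\<psi>\<^sub>0 x)\<close>
  over all extensions \<open>\<psi>\<close> and all \<open>x \<in> G\<close>. Summing over \<open>x\<close> first gives \<open>|G|\<close>, by orthogonality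
  of characters; summing over \<open>\<psi>\<close> first, only the points of \<open>H\<close> contribute, and each contributes
  the number of extensions.

  Both the fixed extension and the separating character come from extending characters
  one generator \<open>a\<close> at a time (\<open>extend_character_by_element\<close>): if \<open>n\<close> is the order of \<open>a\<close> modulo
  \<open>H\<close>, any complex \<open>n\<close>-th root of \<open>\<chi> (a\<^sup>n)\<close> may be taken as the value at \<open>a\<close>.
\<close>

section \<open>Characters of a subgroup\<close>

lemma unimodular_mult_cnj: "cmod z = 1 \<Longrightarrow> z * cnj z = 1"
  by (metis complex_norm_square of_real_1 power_one)

lemma in_dual_group_iff:
  "\<chi> \<in> carrier (dual_group K) \<longleftrightarrow>
     (\<forall>x\<in>carrier K. cmod (\<chi> x) = 1) \<and>
     (\<forall>x\<in>carrier K. \<forall>y\<in>carrier K. \<chi> (x \<otimes>\<^bsub>K\<^esub> y) = \<chi> x * \<chi> y) \<and>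
     \<chi> \<in> extensional (carrier K)"
  by (auto simp: dual_group_def hom_def circle_group_def)

lemma character_one:
  assumes "group K" "\<chi> \<in> carrier (dual_group K)"
  shows "\<chi> \<one>\<^bsub>K\<^esub> = 1"
proof -
  interpret group K by fact
  have "\<chi> \<one>\<^bsub>K\<^esub> = \<chi> \<one>\<^bsub>K\<^esub> * \<chi> \<one>\<^bsub>K\<^esub>" "cmod (\<chi> \<one>\<^bsub>K\<^esub>) = 1"
    using assms(2) unfolding in_dual_group_iff by (metis one_closed r_one)+
  then show ?thesis by auto
qed

lemma character_pow:
  assumes "group K" "\<chi> \<in> carrier (dual_group K)" "x \<in> carrier K"
  shows "\<chi> (x [^]\<^bsub>K\<^esub> (m::nat)) = \<chi> x ^ m"
proof -
  interpret group K by fact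
  show ?thesis
    using assms(2,3) character_one[OF assms(1,2)]
    by (induction m) (auto simp: in_dual_group_iff)
qed

lemma finite_dual_group:
  assumes "group K" "finite (carrier K)"
  shows "finite (carrier (dual_group K))"
proof -
  interpret group K by fact
  have pos: "order K > 0"
    using assms(2) order_gt_0_iff_finite by blast
  \<comment> \<open>By Lagrange every value of a character is a root of unity of order dividing \<open>|K|\<close>.\<close>
  have "carrier (dual_group K) \<subseteq> carrier K \<rightarrow>\<^sub>E {z. z ^ order K = 1}"
  proof
    fix \<chi> assume \<chi>: "\<chi> \<in> carrier (dual_group K)"
    then have "\<chi> x ^ order K = 1" if "x \<in> carrier K" for x
      using character_pow[OF assms(1) \<chi> that, of "order K"] character_one[OF assms(1) \<chi>]
        pow_order_eq_1[OF that] by simp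
    then show "\<chi> \<in> carrier K \<rightarrow>\<^sub>E {z. z ^ order K = 1}"
      using \<chi> by (auto simp: in_dual_group_iff PiE_iff)
  qed
  moreover have "finite {z::complex. z ^ order K = 1}"
    using finite_roots_unity[of "order K"] pos by simp
  ultimately show ?thesis
    using assms(2) by (meson finite_PiE finite_subset)
qed

section \<open>Extending characters\<close>

context comm_group
begin

lemma order_modulo_subgroup:
  assumes "finite (carrier G)" "subgroup H G" "a \<in> carrier G"
  obtains n :: nat where "n > 0" "\<And>m. a [^] m \<in> H \<longleftrightarrow> n dvd m"
proof -
  interpret H: subgroup H G by fact
  define n where "n = (LEAST n::nat. n > 0 \<and> a [^] n \<in> H)"
  have "order G > 0 \<and> a [^] order G \<in> H"
    using assms order_gt_0_iff_finite pow_order_eq_1[OF assms(3)] by auto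
  then have n: "n > 0 \<and> a [^] n \<in> H"
    unfolding n_def by (rule LeastI)
  have multiples: "a [^] (n * k) \<in> H" for k
  proof (induction k)
    case (Suc k)
    then show ?case
      using n assms(3) by (simp flip: nat_pow_mult)
  qed (use assms in simp)
  show thesis
  proof
    show "n > 0" using n by simp
    fix m
    show "a [^] m \<in> H \<longleftrightarrow> n dvd m"
    proof
      assume m: "a [^] m \<in> H"
      have "a [^] m = a [^] (n * (m div n)) \<otimes> a [^] (m mod n)"
        using assms(3) by (simp add: nat_pow_mult)
      then have "a [^] (m mod n) = inv (a [^] (n * (m div n))) \<otimes> a [^] m"
        using assms(3) by (simp flip: m_assoc)
      then have "a [^] (m mod n) \<in> H"
        using m multiples by simp
      moreover have "m mod n < n" using n by simp
      ultimately have "m mod n = 0"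
        using not_less_Least[of "m mod n" "\<lambda>n. n > 0 \<and> a [^] n \<in> H", folded n_def] by simp
      then show "n dvd m" by auto
    qed (use multiples in auto)
  qed
qed

text \<open>
  The subgroup generated by \<open>H\<close> and \<open>a\<close> consists of the elements \<open>h \<otimes> a [^] k\<close>, and the only
  candidate for the extension sends such an element to \<open>\<chi> h * z ^ k\<close>. The representation is
  unique up to shifting powers of \<open>a [^] n\<close> between the two factors, and the condition on \<open>z\<close> says
  that this shift does not change the value.
\<close>
lemma extend_character_by_element:
  assumes "finite (carrier G)" and H: "subgroup H G"
    and \<chi>: "\<chi> \<in> carrier (dual_group (G\<lparr>carrier := H\<rparr>))"
    and a: "a \<in> carrier G" and n: "n > 0" "\<And>m::nat. a [^] m \<in> H \<longleftrightarrow> n dvd m"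
    and z: "z ^ n = \<chi> (a [^] n)"
  obtains K \<psi> where "subgroup K G" "H \<subseteq> K" "a \<in> K"
    "\<psi> \<in> carrier (dual_group (G\<lparr>carrier := K\<rparr>))" "restrict \<psi> H = \<chi>" "\<psi> a = z"
proof -
  interpret H: subgroup H G by fact
  have grp: "group (G\<lparr>carrier := H\<rparr>)" by (rule subgroup_imp_group[OF H])
  have \<chi>_mult: "\<chi> (x \<otimes> y) = \<chi> x * \<chi> y" if "x \<in> H" "y \<in> H" for x y
    using \<chi> that by (simp add: in_dual_group_iff)
  have \<chi>_norm: "cmod (\<chi> x) = 1" if "x \<in> H" for x
    using \<chi> that by (simp add: in_dual_group_iff)
  have \<chi>_one: "\<chi> \<one> = 1" using character_one[OF grp \<chi>] by simp
  have an: "a [^] n \<in> H" using n by simp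
  have z_pow: "z ^ m = \<chi> (a [^] m)" if am: "a [^] m \<in> H" for m
  proof -
    obtain k where k: "m = n * k" using am n(2) by (auto elim: dvdE)
    have "\<chi> ((a [^] n) [^] k) = \<chi> (a [^] n) ^ k"
      using character_pow[OF grp \<chi>, of "a [^] n" k] an
      by (simp add: nat_pow_consistent[symmetric])
    then show ?thesis using a z by (simp add: k power_mult nat_pow_pow)
  qed
  have z_norm: "cmod z = 1"
  proof -
    have "cmod z ^ n = 1" using z \<chi>_norm[OF an] by (metis norm_power)
    then show ?thesis using n(1) power_eq_imp_eq_base[of "cmod z" n 1] by simp
  qed
  define K where "K = {h \<otimes> a [^] k | h k::nat. h \<in> H}"
  have shift: "\<chi> h * z ^ k = \<chi> h' * z ^ l"
    if "h \<in> H" "h' \<in> H" "k \<le> l" "h \<otimes> a [^] k = h' \<otimes> a [^] l" for h h' and k l :: nat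
  proof -
    have "a [^] l = a [^] (l - k) \<otimes> a [^] k"
      using a that(3) by (simp add: nat_pow_mult)
    then have "h \<otimes> a [^] k = (h' \<otimes> a [^] (l - k)) \<otimes> a [^] k"
      using that a by (simp add: m_assoc)
    then have h: "h = h' \<otimes> a [^] (l - k)"
      using that a by simp
    then have "a [^] (l - k) = inv h' \<otimes> h"
      using that a by (simp flip: m_assoc)
    then have d: "a [^] (l - k) \<in> H"
      using that by simp
    have "\<chi> h = \<chi> h' * z ^ (l - k)"
      using h d that(2) z_pow[OF d] \<chi>_mult by simp
    then show ?thesis
      using that(3) by (simp flip: power_add)
  qed
  have well_defined: "\<chi> h * z ^ k = \<chi> h' * z ^ l"
    if "h \<in> H" "h' \<in> H" "h \<otimes> a [^] k = h' \<otimes> a [^] l" for h h' and k l :: nat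
  proof (cases "k \<le> l")
    case True
    then show ?thesis using shift[OF that(1,2) _ that(3)] by simp
  next
    case False
    then show ?thesis using shift[OF that(2,1) _ that(3)[symmetric]] by simp
  qed
  define \<psi> where
    "\<psi> = (\<lambda>x\<in>K. THE w. \<exists>h\<in>H. \<exists>k::nat. x = h \<otimes> a [^] k \<and> w = \<chi> h * z ^ k)"
  have \<psi>: "\<psi> (h \<otimes> a [^] k) = \<chi> h * z ^ k" if "h \<in> H" for h and k :: nat
  proof -
    have "(THE w. \<exists>h'\<in>H. \<exists>l::nat. h \<otimes> a [^] k = h' \<otimes> a [^] l \<and> w = \<chi> h' * z ^ l) =
        \<chi> h * z ^ k"
    proof (rule the_equality)
      fix w assume "\<exists>h'\<in>H. \<exists>l::nat. h \<otimes> a [^] k = h' \<otimes> a [^] l \<and> w = \<chi> h' * z ^ l"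
      then obtain h' l where "h' \<in> H" "h \<otimes> a [^] k = h' \<otimes> a [^] (l::nat)" "w = \<chi> h' * z ^ l"
        by blast
      then show "w = \<chi> h * z ^ k" using well_defined[OF that, of h' k l] by simp
    qed (use that in blast)
    moreover have "h \<otimes> a [^] k \<in> K" using that unfolding K_def by blast
    ultimately show ?thesis by (simp add: \<psi>_def)
  qed
  have prod: "(h \<otimes> a [^] k) \<otimes> (h' \<otimes> a [^] l) = (h \<otimes> h') \<otimes> a [^] (k + l)"
    if "h \<in> H" "h' \<in> H" for h h' and k l :: nat
    using that a by (simp add: m_ac flip: nat_pow_mult)
  have subgroupK: "subgroup K G"
  proof (rule subgroupI)
    show "K \<subseteq> carrier G" using a by (auto simp: K_def)
    show "K \<noteq> {}" unfolding K_def using H.one_closed by blast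
  next
    fix x assume "x \<in> K"
    then obtain h k where x: "x = h \<otimes> a [^] (k::nat)" "h \<in> H" by (auto simp: K_def)
    \<comment> \<open>Only nonnegative powers of \<open>a\<close> occur in \<open>K\<close>; as \<open>a [^] (n * k)\<close> lies in \<open>H\<close>,
      inverses may be written with the exponent \<open>n * k - k\<close>.\<close>
    let ?y = "inv h \<otimes> inv (a [^] (n * k)) \<otimes> a [^] (n * k - k)"
    have nk: "a [^] (n * k) \<in> H" using n by simp
    have "a [^] (n * k) = a [^] (n * k - k) \<otimes> a [^] k"
      using a n(1) by (simp add: nat_pow_mult)
    then have "inv (a [^] (n * k)) \<otimes> (a [^] (n * k - k) \<otimes> a [^] k) = \<one>"
      using a by (metis l_inv nat_pow_closed)
    moreover have "?y \<otimes> x =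
        (inv h \<otimes> h) \<otimes> (inv (a [^] (n * k)) \<otimes> (a [^] (n * k - k) \<otimes> a [^] k))"
      using x a by (simp only: m_ac m_closed inv_closed nat_pow_closed H.mem_carrier)
    ultimately have "?y \<otimes> x = \<one>"
      using x by simp
    then have "inv x = ?y"
      using x a by (intro inv_equality) auto
    then show "inv x \<in> K"
      using x nk unfolding K_def by auto
  next
    fix x y assume "x \<in> K" "y \<in> K"
    then show "x \<otimes> y \<in> K"
      using prod H.m_closed unfolding K_def by blast
  qed
  have HK: "h \<in> K" "\<psi> h = \<chi> h" if "h \<in> H" for h
    using \<psi>[OF that, of 0] that by (auto simp: K_def intro!: exI[of _ h] exI[of _ "0::nat"])
  show thesis
  proof (rule that[OF subgroupK])
    show "H \<subseteq> K" using HK by auto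
    show "a \<in> K" using a by (auto simp: K_def intro!: exI[of _ \<one>] exI[of _ "1::nat"])
    show "\<psi> a = z" using \<psi>[of \<one> 1] a \<chi>_one by simp
    show "restrict \<psi> H = \<chi>"
      using HK \<chi> by (auto simp: fun_eq_iff in_dual_group_iff extensional_def)
    have "\<psi> (x \<otimes> y) = \<psi> x * \<psi> y" if "x \<in> K" "y \<in> K" for x y
      using that \<psi> \<chi>_mult by (auto simp: K_def prod power_add)
    moreover have "cmod (\<psi> x) = 1" if "x \<in> K" for x
      using that \<psi> \<chi>_norm z_norm by (auto simp: K_def norm_mult norm_power)
    moreover have "\<psi> \<in> extensional K" by (simp add: \<psi>_def)
    ultimately show "\<psi> \<in> carrier (dual_group (G\<lparr>carrier := K\<rparr>))"
      by (simp add: in_dual_group_iff)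
  qed
qed

lemma extend_character:
  assumes "finite (carrier G)" "subgroup H G" "\<chi> \<in> carrier (dual_group (G\<lparr>carrier := H\<rparr>))"
  obtains \<psi> where "\<psi> \<in> characters_extending G H \<chi>"
proof -
  have "\<exists>\<psi>. \<psi> \<in> characters_extending G H \<chi>"
    using assms(2,3)
  proof (induction "card (carrier G) - card H" arbitrary: H \<chi> rule: less_induct)
    case less
    interpret H: subgroup H G by fact
    show ?case
    proof (cases "H = carrier G")
      case True
      then have "\<chi> \<in> carrier (dual_group G)" "restrict \<chi> H = \<chi>"
        using less.prems(2) by (auto simp: in_dual_group_iff fun_eq_iff extensional_def)
      then show ?thesis by (auto simp: characters_extending_def)
    next
      case False
      then obtain a where a: "a \<in> carrier G" "a \<notin> H" using H.subset by auto
      obtain n where n: "n > 0" "\<And>m::nat. a [^] m \<in> H \<longleftrightarrow> n dvd m"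
        using order_modulo_subgroup[OF assms(1) less.prems(1) a(1)] by blast
      have "cmod (\<chi> (a [^] n)) = 1"
        using less.prems(2) n by (simp add: in_dual_group_iff)
      then have "card {z. z ^ n = \<chi> (a [^] n)} = n"
        using n(1) by (intro card_nth_roots) auto
      then obtain z where z: "z ^ n = \<chi> (a [^] n)"
        using n(1) by (metis (mono_tags, lifting) card.empty empty_Collect_eq less_irrefl)
      obtain K \<psi> where K: "subgroup K G" "H \<subseteq> K" "a \<in> K"
        "\<psi> \<in> carrier (dual_group (G\<lparr>carrier := K\<rparr>))" "restrict \<psi> H = \<chi>"
        using extend_character_by_element[OF assms(1) less.prems a(1) n z] by metis
      have KG: "K \<subseteq> carrier G" using K(1) by (rule subgroup.subset)
      have "card H < card K"
        using K(2,3) a(2) KG assms(1) by (intro psubset_card_mono) (auto intro: finite_subset)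
      moreover have "card K \<le> card (carrier G)"
        using KG assms(1) by (rule card_mono[rotated])
      ultimately obtain \<phi> where \<phi>: "\<phi> \<in> characters_extending G K \<psi>"
        using less.hyps[OF _ K(1,4)] by (metis diff_less_mono2 order_less_le_trans)
      then have "restrict (restrict \<phi> K) H = \<chi>"
        using K(5) by (simp add: characters_extending_def)
      then have "restrict \<phi> H = \<chi>"
        using K(2) by (simp add: inf.absorb2)
      then show ?thesis using \<phi> by (auto simp: characters_extending_def)
    qed
  qed
  then show thesis using that by blast
qed

text \<open>
  The order \<open>n\<close> of \<open>x\<close> modulo \<open>H\<close> exceeds one, so there is an \<open>n\<close>-th root of unity other
  than one, which may be prescribed as the value at \<open>x\<close> of an extension of the trivial character.
\<close>
lemma separating_character:
  assumes "finite (carrier G)" "subgroup H G" "x \<in> carrier G" "x \<notin> H"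
  obtains \<theta> where "\<theta> \<in> carrier (dual_group G)" "\<And>h. h \<in> H \<Longrightarrow> \<theta> h = 1" "\<theta> x \<noteq> 1"
proof -
  interpret H: subgroup H G by fact
  let ?one = "\<lambda>h\<in>H. 1 :: complex"
  have one: "?one \<in> carrier (dual_group (G\<lparr>carrier := H\<rparr>))"
    by (auto simp: in_dual_group_iff)
  obtain n where n: "n > 0" "\<And>m::nat. x [^] m \<in> H \<longleftrightarrow> n dvd m"
    using order_modulo_subgroup[OF assms(1-3)] by blast
  have "n \<noteq> 1" using n(2)[of 1] assms(3,4) by auto
  moreover have "card {z::complex. z ^ n = 1} = n"
    using n(1) by (intro card_nth_roots) auto
  ultimately have "\<not> {z::complex. z ^ n = 1} \<subseteq> {1}"
    using n(1) card_mono[of "{1::complex}" "{z. z ^ n = 1}"] by fastforce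
  then obtain z :: complex where z: "z ^ n = 1" "z \<noteq> 1" by auto
  then have "z ^ n = ?one (x [^] n)" using n(2) by simp
  then obtain K \<psi> where K: "subgroup K G" "H \<subseteq> K" "x \<in> K"
    "\<psi> \<in> carrier (dual_group (G\<lparr>carrier := K\<rparr>))" "restrict \<psi> H = ?one" "\<psi> x = z"
    using extend_character_by_element[OF assms(1,2) one assms(3) n] by metis
  obtain \<theta> where \<theta>: "\<theta> \<in> carrier (dual_group G)" "restrict \<theta> K = \<psi>"
    using extend_character[OF assms(1) K(1,4)] by (auto simp: characters_extending_def)
  show thesis
  proof (rule that[OF \<theta>(1)])
    show "\<theta> x \<noteq> 1" using \<theta>(2) K(3,6) z(2) by (metis restrict_apply')
    show "\<theta> h = 1" if "h \<in> H" for h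
      using \<theta>(2) K(2,5) that by (metis restrict_apply' subsetD)
  qed
qed

section \<open>Sums over the extensions of a character\<close>

lemma sum_extensions_outside:
  assumes "finite (carrier G)" "subgroup H G" "x \<in> carrier G" "x \<notin> H"
  shows "(\<Sum>\<psi>\<in>characters_extending G H \<chi>. \<psi> x) = 0"
proof -
  interpret H: subgroup H G by fact
  interpret D: comm_group "dual_group G"
    by (rule comm_group_dual_group) (rule is_group)
  obtain \<theta> where \<theta>: "\<theta> \<in> carrier (dual_group G)" "\<And>h. h \<in> H \<Longrightarrow> \<theta> h = 1" "\<theta> x \<noteq> 1"
    using separating_character[OF assms] by metis
  define E where "E = characters_extending G H \<chi>"
  define t where "t \<psi> = \<theta> \<otimes>\<^bsub>dual_group G\<^esub> \<psi>" for \<psi>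
  have t_apply: "t \<psi> y = \<theta> y * \<psi> y" if "y \<in> carrier G" for \<psi> y
    using that by (simp add: t_def dual_group_def)
  have finE: "finite E"
    using finite_dual_group[OF is_group assms(1)] by (auto simp: E_def characters_extending_def)
  have inj: "inj_on t E"
    using \<theta>(1) by (auto simp: inj_on_def t_def E_def characters_extending_def)
  have "t ` E \<subseteq> E"
  proof safe
    fix \<psi> assume \<psi>: "\<psi> \<in> E"
    then have "t \<psi> \<in> carrier (dual_group G)"
      using \<theta>(1) by (auto simp: t_def E_def characters_extending_def)
    moreover have "restrict (t \<psi>) H = restrict \<psi> H"
      using \<theta>(2) by (auto simp: fun_eq_iff restrict_def t_apply)
    ultimately show "t \<psi> \<in> E"
      using \<psi> by (simp add: E_def characters_extending_def)
  qed
  then have "t ` E = E"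
    using inj finE by (metis endo_inj_surj)
  then have "(\<Sum>\<psi>\<in>E. \<psi> x) = (\<Sum>\<psi>\<in>E. t \<psi> x)"
    using sum.reindex[OF inj, of "\<lambda>\<psi>. \<psi> x"] by simp
  also have "\<dots> = \<theta> x * (\<Sum>\<psi>\<in>E. \<psi> x)"
    using assms(3) by (simp add: t_apply sum_distrib_left)
  finally show ?thesis
    using \<theta>(3) by (simp add: E_def)
qed

lemma character_orthogonality:
  assumes "finite (carrier G)"
    and \<phi>: "\<phi> \<in> carrier (dual_group G)" and \<psi>: "\<psi> \<in> carrier (dual_group G)"
  shows "(\<Sum>x\<in>carrier G. \<phi> x * cnj (\<psi> x)) = (if \<phi> = \<psi> then of_nat (order G) else 0)"
proof (cases "\<phi> = \<psi>")
  case True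
  have "\<psi> x * cnj (\<psi> x) = 1" if "x \<in> carrier G" for x
    using \<psi> that by (simp add: in_dual_group_iff unimodular_mult_cnj)
  then show ?thesis using True by (simp add: order_def)
next
  case False
  define S where "S = (\<Sum>x\<in>carrier G. \<phi> x * cnj (\<psi> x))"
  obtain a where a: "a \<in> carrier G" "\<phi> a \<noteq> \<psi> a"
    using False \<phi> \<psi> by (metis in_dual_group_iff extensionalityI)
  have "bij_betw (\<lambda>x. a \<otimes> x) (carrier G) (carrier G)"
    using a(1) assms(1) by (simp add: bij_betw_def inj_on_multc inj_on_cmult surj_const_mult)
  then have "S = (\<Sum>x\<in>carrier G. \<phi> (a \<otimes> x) * cnj (\<psi> (a \<otimes> x)))"
    unfolding S_def by (rule sum.reindex_bij_betw[symmetric])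
  also have "\<dots> = (\<phi> a * cnj (\<psi> a)) * S"
    unfolding S_def sum_distrib_left
    using a \<phi> \<psi> by (intro sum.cong) (auto simp: in_dual_group_iff)
  finally have "S = 0 \<or> \<phi> a * cnj (\<psi> a) = 1"
    by auto
  moreover have "\<phi> a * cnj (\<psi> a) \<noteq> 1"
  proof
    assume eq: "\<phi> a * cnj (\<psi> a) = 1"
    have "cnj (\<psi> a) * \<psi> a = 1"
      using \<psi> a(1) by (simp add: in_dual_group_iff unimodular_mult_cnj mult.commute[of "cnj _"])
    then have "\<phi> a = (\<phi> a * cnj (\<psi> a)) * \<psi> a" by (simp add: mult.assoc)
    then show False using eq a(2) by simp
  qed
  ultimately show ?thesis using False by (simp add: S_def)
qed

lemma card_characters_extending:
  assumes "finite (carrier G)" "subgroup H G" "\<chi> \<in> carrier (dual_group (G\<lparr>carrier := H\<rparr>))"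
  shows "card (characters_extending G H \<chi>) = subgroup_index G H"
proof -
  interpret H: subgroup H G by fact
  define E where "E = characters_extending G H \<chi>"
  have E: "\<psi> \<in> carrier (dual_group G)" "\<And>h. h \<in> H \<Longrightarrow> \<psi> h = \<chi> h" if "\<psi> \<in> E" for \<psi>
    using that by (auto simp: E_def characters_extending_def)
  have finE: "finite E"
    using finite_dual_group[OF is_group assms(1)] by (auto simp: E_def characters_extending_def)
  have finH: "finite H" using assms(1) H.subset by (rule finite_subset[rotated])
  obtain \<psi>\<^sub>0 where \<psi>\<^sub>0: "\<psi>\<^sub>0 \<in> E"
    using extend_character[OF assms] by (auto simp: E_def)
  define T where "T = (\<Sum>\<psi>\<in>E. \<Sum>x\<in>carrier G. \<psi> x * cnj (\<psi>\<^sub>0 x))"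
  have "T = (\<Sum>\<psi>\<in>E. if \<psi> = \<psi>\<^sub>0 then of_nat (order G) else 0)"
    unfolding T_def using E(1) \<psi>\<^sub>0 by (intro sum.cong refl character_orthogonality assms(1))
  then have T1: "T = of_nat (order G)"
    using finE \<psi>\<^sub>0 by simp
  have "T = (\<Sum>x\<in>carrier G. (\<Sum>\<psi>\<in>E. \<psi> x) * cnj (\<psi>\<^sub>0 x))"
    unfolding T_def by (subst sum.swap) (simp add: sum_distrib_right)
  also have "\<dots> = (\<Sum>x\<in>H. (\<Sum>\<psi>\<in>E. \<psi> x) * cnj (\<psi>\<^sub>0 x))"
    using sum_extensions_outside[OF assms(1,2)] assms(1) H.subset
    by (intro sum.mono_neutral_right) (auto simp: E_def)
  also have "\<dots> = (\<Sum>x\<in>H. of_nat (card E))"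
  proof (intro sum.cong refl)
    fix x assume x: "x \<in> H"
    have "\<chi> x * cnj (\<chi> x) = 1"
      using assms(3) x by (simp add: in_dual_group_iff unimodular_mult_cnj)
    moreover have "(\<Sum>\<psi>\<in>E. \<psi> x) = of_nat (card E) * \<chi> x"
      using x by (simp add: E(2))
    ultimately show "(\<Sum>\<psi>\<in>E. \<psi> x) * cnj (\<psi>\<^sub>0 x) = of_nat (card E)"
      by (simp add: E(2)[OF \<psi>\<^sub>0 x] mult.assoc)
  qed
  finally have "(of_nat (order G) :: complex) = of_nat (card H * card E)"
    using T1 by simp
  then have "order G = card H * card E"
    by (simp only: of_nat_eq_iff)
  moreover have "subgroup_index G H * card H = order G"
    unfolding subgroup_index_def by (rule lagrange_finite[OF assms(1,2)])
  moreover have "card H > 0"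
    using finH H.one_closed card_gt_0_iff by blast
  ultimately show ?thesis
    by (simp add: E_def mult.commute)
qed

lemma sum_extensions:
  assumes "finite (carrier G)" "subgroup H G" "\<chi> \<in> carrier (dual_group (G\<lparr>carrier := H\<rparr>))"
    and "x \<in> carrier G"
  shows "(\<Sum>\<psi>\<in>characters_extending G H \<chi>. \<psi> x) =
           (if x \<in> H then of_nat (subgroup_index G H) * \<chi> x else 0)"
proof (cases "x \<in> H")
  case True
  then have "(\<Sum>\<psi>\<in>characters_extending G H \<chi>. \<psi> x) = (\<Sum>\<psi>\<in>characters_extending G H \<chi>. \<chi> x)"
    by (intro sum.cong) (auto simp: characters_extending_def)
  then show ?thesis
    using True card_characters_extending[OF assms(1-3)] by simp
qed (use sum_extensions_outside assms in simp)

end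

section \<open>Fourier transforms of sampled and upsampled functions\<close>

theorem proposition3p7:
  fixes G :: "('a, 'm) monoid_scheme" and H :: "'a set"
  assumes "comm_group G" and "finite (carrier G)" and "subgroup H G"
  shows "(\<forall>f\<in>ell (G\<lparr>carrier := H\<rparr>). \<forall>\<chi>\<in>carrier (dual_group G).
            dft G (upsampling G H f) \<chi> = dft (G\<lparr>carrier := H\<rparr>) f (restrict \<chi> H)) \<and>
         (\<forall>f\<in>ell G. \<forall>\<chi>\<in>carrier (dual_group (G\<lparr>carrier := H\<rparr>)).
            dft (G\<lparr>carrier := H\<rparr>) (sampling H f) \<chi> =
              1 / of_nat (subgroup_index G H) * (\<Sum>\<psi>\<in>characters_extending G H \<chi>. dft G f \<psi>))"
proof (intro conjI ballI)
  interpret comm_group G by fact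
  interpret H: subgroup H G by fact
  fix f \<chi>
  assume \<chi>: "\<chi> \<in> carrier (dual_group G)"
  have "dft G (upsampling G H f) \<chi> = (\<Sum>x\<in>carrier G. if x \<in> H then f x * cnj (\<chi> x) else 0)"
    using \<chi> by (auto simp: dft_def upsampling_def intro!: sum.cong)
  also have "\<dots> = (\<Sum>x\<in>H. f x * cnj (\<chi> x))"
    using assms(2) H.subset by (intro sum.mono_neutral_cong_right) auto
  also have "\<dots> = dft (G\<lparr>carrier := H\<rparr>) f (restrict \<chi> H)"
    using restrict_in_dual_group[OF assms(3) \<chi>] by (simp add: dft_def)
  finally show "dft G (upsampling G H f) \<chi> = dft (G\<lparr>carrier := H\<rparr>) f (restrict \<chi> H)" .
next
  interpret comm_group G by fact
  interpret H: subgroup H G by fact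
  fix f \<chi>
  assume \<chi>: "\<chi> \<in> carrier (dual_group (G\<lparr>carrier := H\<rparr>))"
  let ?E = "characters_extending G H \<chi>" and ?m = "of_nat (subgroup_index G H) :: complex"
  have "subgroup_index G H * card H = order G"
    unfolding subgroup_index_def by (rule lagrange_finite[OF assms(2,3)])
  then have m: "?m \<noteq> 0"
    using assms(2) order_gt_0_iff_finite by (metis mult_0 less_irrefl of_nat_eq_0_iff)
  have "(\<Sum>\<psi>\<in>?E. dft G f \<psi>) = (\<Sum>\<psi>\<in>?E. \<Sum>x\<in>carrier G. f x * cnj (\<psi> x))"
    by (intro sum.cong) (auto simp: dft_def characters_extending_def)
  also have "\<dots> = (\<Sum>x\<in>carrier G. f x * cnj (\<Sum>\<psi>\<in>?E. \<psi> x))"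
    by (subst sum.swap) (simp add: sum_distrib_left)
  also have "\<dots> = (\<Sum>x\<in>carrier G. if x \<in> H then ?m * (f x * cnj (\<chi> x)) else 0)"
    using sum_extensions[OF assms(2,3) \<chi>] by (intro sum.cong) (auto simp: mult_ac)
  also have "\<dots> = (\<Sum>x\<in>H. ?m * (f x * cnj (\<chi> x)))"
    using assms(2) H.subset by (intro sum.mono_neutral_cong_right) auto
  also have "\<dots> = ?m * dft (G\<lparr>carrier := H\<rparr>) (sampling H f) \<chi>"
    using \<chi> by (simp add: dft_def sampling_def sum_distrib_left)
  finally show "dft (G\<lparr>carrier := H\<rparr>) (sampling H f) \<chi> = 1 / ?m * (\<Sum>\<psi>\<in>?E. dft G f \<psi>)"
    using m by simp
qed

end
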